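(* If $n\geq 0$, then $$A_{2n+1}(-1,1)=\sum_{i=0}^{\lfloor n/2\rfloor}(2i-1)!!\,S_{n,2i}$$ and $$A_{2n+2}(-1,1)=\sum_{i=0}^{\lfloor n/2\rfloor}\sum_{j=2i}^n(2i-1)!!\binom{n}{j}S_{j,2i}.$$
   Context: Permutations $\pi=\pi_1\cdots\pi_n$ of $[n]=\{1,\ldots,n\}$ are written in one-line notation. $\mathrm{inv}(\pi)$ is the number of pairs $(i,j)$ with $1\le i<j\le n$ and $\pi_i>\pi_j$. A run of $\pi$ is a maximal increasing sequence of consecutive entries; $\mathrm{run}(\pi)$ is the number of runs. A permutation is run-sorted if $\pi_1=1$ and the first entries of its runs, read from left to right, form an increasing sequence. $\mathcal{R}_n$ denotes the set of run-sorted permutations of $[n]$, and $A_n(q,u)=\sum_{\pi\in\mathcal{R}_n}q^{\mathrm{inv}(\pi)}u^{\mathrm{run}(\pi)}$ for $n\ge1$; thus $A_n(-1,1)=\sum_{\pi\in\mathcal{R}_n}(-1)^{\mathrm{inv}(\pi)}$. For an odd positive integer $m$, $m!!=m(m-2)\cdots 1$, and $(-1)!!=1$. $S_{n,k}$ is the Stirling number of the second kind (number of set partitions of $[n]$ into exactly $k$ blocks, $S_{0,0}=1$). *)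

theory Defs
  imports
    "HOL-Combinatorics.Stirling"
    "HOL-Combinatorics.Multiset_Permutations"
    "HOL-Library.Disjoint_Sets"
begin

text \<open>
  A permutation of \<open>{1..n}\<close> in one-line notation is a list in
  \<^term>\<open>permutations_of_set {1..n}\<close>. List positions start at 0.
\<close>

definition inversions :: "nat list \<Rightarrow> nat" where
  "inversions xs = card {(i, j). i < j \<and> j < length xs \<and> xs ! i > xs ! j}"

text \<open>A nonempty segment of consecutive entries is given by its first and last position.\<close>

definition increasing_segment :: "nat list \<Rightarrow> nat \<Rightarrow> nat \<Rightarrow> bool" where
  "increasing_segment xs i j \<longleftrightarrow> i \<le> j \<and> j < length xs \<and> strict_mono_on {i..j} (\<lambda>k. xs ! k)"

definition is_run :: "nat list \<Rightarrow> nat \<Rightarrow> nat \<Rightarrow> bool" where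
  "is_run xs i j \<longleftrightarrow> increasing_segment xs i j \<and>
     (\<forall>i' j'. i' \<le> i \<and> j \<le> j' \<and> increasing_segment xs i' j' \<longrightarrow> i' = i \<and> j' = j)"

definition num_runs :: "nat list \<Rightarrow> nat" where
  "num_runs xs = card {(i, j). is_run xs i j}"

definition run_sorted :: "nat list \<Rightarrow> bool" where
  "run_sorted xs \<longleftrightarrow> xs \<noteq> [] \<and> hd xs = 1 \<and>
     strict_mono_on {i. \<exists>j. is_run xs i j} (\<lambda>i. xs ! i)"

definition run_sorted_perms :: "nat \<Rightarrow> nat list set" where
  "run_sorted_perms n = {xs \<in> permutations_of_set {1..n}. run_sorted xs}"

definition A_poly :: "nat \<Rightarrow> 'a::comm_ring_1 \<Rightarrow> 'a \<Rightarrow> 'a" where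
  "A_poly n q u = (\<Sum>xs\<in>run_sorted_perms n. q ^ inversions xs * u ^ num_runs xs)"

text \<open>
  The argument is an integer so that \<open>(-1)!!\<close> is literally the empty product;
  truncated subtraction on the naturals would turn it into \<open>0!!\<close>.
\<close>

definition double_fact :: "int \<Rightarrow> int" where
  "double_fact m = (\<Prod>k | k \<in> {1..m} \<and> even (m - k). k)"

text \<open>
  The library introduces \<^const>\<open>Stirling\<close> by its recurrence; the following lemma
  identifies it with the number of set partitions into a given number of blocks.
\<close>

lemma card_partitions_eq_Stirling:
  assumes "finite A"
  shows "card {P. partition_on (A :: 'a set) P \<and> card P = k} = Stirling (card A) k"
  using assms
proof (induction A arbitrary: k rule: finite_induct)
  case empty
  have "{P. partition_on ({} :: 'a set) P \<and> card P = k} = (if k = 0 then {{}} else {})"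
    for k :: nat by (auto simp: partition_on_empty)
  then show ?case by (cases k) simp_all
next
  case (insert a A)
  let ?Part = "\<lambda>A k. {P. partition_on A P \<and> card P = k}"
  have finP: "finite P" if "partition_on A P" for P
    using finite_elements[OF insert.hyps(1) that] .
  have finPart: "finite (?Part A k)" for k
    by (rule finite_subset[of _ "Pow (Pow A)"])
       (auto simp: partition_on_def insert.hyps(1))
  have finI: "finite P" if "partition_on (insert a A) P" for P
    using finite_elements[OF _ that] insert.hyps(1) by simp
  show ?case
  proof (cases k)
    case 0
    have "?Part (insert a A) 0 = {}"
    proof (intro equalityI subsetI)
      fix Q assume "Q \<in> ?Part (insert a A) 0"
      then have Q: "partition_on (insert a A) Q" and "card Q = 0" by auto
      then have "Q = {}" using finI by simp
      then show "Q \<in> {}" using Q by (simp add: partition_on_def)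
    qed simp
    then show ?thesis unfolding 0 using insert.hyps by (simp only: card_insert_disjoint[OF insert.hyps] Stirling.simps card.empty)
  next
    case (Suc m)
    define f where "f = (\<lambda>(P, B). insert (insert a B) (P - {B}))"
    let ?X = "insert {a} ` ?Part A m"
    let ?S = "Sigma (?Part A (Suc m)) (\<lambda>P. P)"
    let ?Y = "f ` ?S"
    have a_notin: "a \<notin> B" if "partition_on A P" "B \<in> P" for P B
      using that insert.hyps(2) by (auto simp: partition_on_def)
    have eq: "?Part (insert a A) (Suc m) = ?X \<union> ?Y"
    proof (intro equalityI subsetI)
      fix Q assume "Q \<in> ?Part (insert a A) (Suc m)"
      then have Q: "partition_on (insert a A) Q" and c: "card Q = Suc m" by auto
      have finQ: "finite Q" using finI Q by blast
      obtain C where C: "C \<in> Q" "a \<in> C" using Q by (auto simp: partition_on_def)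
      have uniq: "D \<inter> C = {}" if "D \<in> Q" "D \<noteq> C" for D
        using Q C that by (auto simp: partition_on_def disjoint_def)
      have UQ: "\<Union>Q = insert a A" and dQ: "disjoint Q" and eQ: "{} \<notin> Q"
        using Q by (auto simp: partition_on_def)
      show "Q \<in> ?X \<union> ?Y"
      proof (cases "C = {a}")
        case True
        have "\<Union>(Q - {C}) = A"
        proof -
          have "\<Union>(Q - {C}) = \<Union>Q - C" using uniq C by blast
          then show ?thesis using UQ True insert.hyps(2) by auto
        qed
        then have "partition_on A (Q - {C})"
          using dQ eQ by (auto simp: partition_on_def disjoint_def)
        moreover have "card (Q - {C}) = m" using c C finQ by simp
        moreover have "Q = insert {a} (Q - {C})" using C True by auto
        ultimately show ?thesis by blast
      next
        case False
        define B where "B = C - {a}"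
        define P where "P = insert B (Q - {C})"
        have Bne: "B \<noteq> {}" using False C by (auto simp: B_def)
        have BQ: "B \<notin> Q"
        proof
          assume "B \<in> Q"
          moreover have "B \<noteq> C" using C by (auto simp: B_def)
          ultimately have "B \<inter> C = {}" using uniq by blast
          then show False using Bne by (auto simp: B_def)
        qed
        have "\<Union>P = A"
        proof -
          have "\<Union>(Q - {C}) = \<Union>Q - C" using uniq C by blast
          then have "\<Union>P = (C - {a}) \<union> (insert a A - C)" using UQ by (simp add: P_def B_def)
          also have "\<dots> = A" using UQ C insert.hyps(2) by blast
          finally show ?thesis .
        qed
        moreover have "disjoint P"
          using dQ uniq unfolding P_def B_def disjoint_def by blast
        moreover have "{} \<notin> P" using eQ Bne by (auto simp: P_def)
        ultimately have "partition_on A P" by (auto simp: partition_on_def)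
        moreover have "card P = Suc m"
          using c C finQ BQ by (simp add: P_def card_insert_if card_Suc_Diff1)
        moreover have "f (P, B) = Q"
        proof -
          have "P - {B} = Q - {C}" using BQ by (auto simp: P_def)
          moreover have "insert a B = C" using C by (auto simp: B_def)
          ultimately show ?thesis using C by (auto simp: f_def)
        qed
        moreover have "B \<in> P" by (simp add: P_def)
        ultimately show ?thesis by (metis (mono_tags, lifting) UnI2 image_eqI mem_Collect_eq mem_Sigma_iff)
      qed
    next
      fix Q assume "Q \<in> ?X \<union> ?Y"
      then show "Q \<in> ?Part (insert a A) (Suc m)"
      proof
        assume "Q \<in> ?X"
        then obtain P where P: "partition_on A P" "card P = m" "Q = insert {a} P" by auto
        have "{a} \<notin> P" using a_notin[OF P(1)] by auto
        moreover have "partition_on (insert a A) Q"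
          using P a_notin[OF P(1)] by (auto simp: partition_on_def disjoint_def)
        ultimately show ?thesis using P finP by simp
      next
        assume "Q \<in> ?Y"
        then obtain P B where P: "partition_on A P" "card P = Suc m" "B \<in> P"
          "Q = insert (insert a B) (P - {B})" by (auto simp: f_def)
        have "insert a B \<notin> P" using a_notin[OF P(1)] by auto
        then have "card Q = Suc m" using P finP[OF P(1)] by (simp add: card_Suc_Diff1)
        moreover have "partition_on (insert a A) Q"
          unfolding partition_on_def
        proof (intro conjI)
          show "\<Union>Q = insert a A" using P by (auto simp: partition_on_def)
          show "disjoint Q"
            unfolding disjoint_def
          proof (intro ballI impI)
            fix D E assume "D \<in> Q" "E \<in> Q" "D \<noteq> E"
            moreover have "\<And>D E. D \<in> P \<Longrightarrow> E \<in> P \<Longrightarrow> D \<noteq> E \<Longrightarrow> D \<inter> E = {}"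
              using P(1) by (auto simp: partition_on_def disjoint_def)
            ultimately show "D \<inter> E = {}"
              using P(3,4) a_notin[OF P(1)] by auto
          qed
          show "{} \<notin> Q" using P by (auto simp: partition_on_def)
        qed
        ultimately show ?thesis by simp
      qed
    qed
    have disj: "?X \<inter> ?Y = {}"
    proof -
      have "{a} \<notin> f (P, B)" if "partition_on A P" "B \<in> P" for P B
      proof -
        have "B \<noteq> {}" using that by (auto simp: partition_on_def)
        then show ?thesis using that a_notin[OF that(1)] by (auto simp: f_def)
      qed
      then show ?thesis by auto
    qed
    have cX: "card ?X = Stirling (card A) m"
    proof -
      have "inj_on (insert {a}) (?Part A m)"
      proof (rule inj_onI)
        fix P P' assume "P \<in> ?Part A m" "P' \<in> ?Part A m" and e: "insert {a} P = insert {a} P'"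
        then have "{a} \<notin> P" "{a} \<notin> P'" using a_notin by blast+
        then show "P = P'" using e by (metis insert_ident)
      qed
      then show ?thesis using insert.IH by (simp add: card_image)
    qed
    have "inj_on f ?S"
    proof (rule inj_onI, clarify)
      fix P B P' B'
      assume P: "partition_on A P" "B \<in> P" and P': "partition_on A P'" "B' \<in> P'"
        and e: "f (P, B) = f (P', B')"
      have n: "\<And>D. D \<in> P \<Longrightarrow> a \<notin> D" "\<And>D. D \<in> P' \<Longrightarrow> a \<notin> D"
        using a_notin P P' by blast+
      have "insert a B \<in> f (P', B')" unfolding e[symmetric] by (simp add: f_def)
      then have "insert a B = insert a B'" using n by (auto simp: f_def)
      then have BB: "B = B'" using n P P' by (metis insert_ident)
      have "P - {B} = f (P, B) - {insert a B}" using n by (auto simp: f_def)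
      also have "\<dots> = P' - {B'}" unfolding e using n BB by (auto simp: f_def)
      finally show "P = P' \<and> B = B'" using BB P P' by blast
    qed
    then have "card ?Y = card ?S" by (simp add: card_image)
    also have "\<dots> = (\<Sum>P\<in>?Part A (Suc m). card P)"
      using finPart finP by (intro card_SigmaI) auto
    also have "\<dots> = Suc m * Stirling (card A) (Suc m)"
      using insert.IH[of "Suc m"] by simp
    finally have cY: "card ?Y = Suc m * Stirling (card A) (Suc m)" .
    have "card (?X \<union> ?Y) = card ?X + card ?Y"
      using finPart finP by (intro card_Un_disjoint disj finite_imageI finite_SigmaI) auto
    then show ?thesis using eq cX cY Suc insert.hyps by simp
  qed
qed

end

theory Submission
  imports Defs
begin

text \<open>
  Consider more generally the words whose letters are the elements of a finite set \<open>X\<close>, each used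
  once, in which every run starts with a letter smaller than all letters to its right (flattened
  words); for \<open>X = {1..n}\<close> these are the run-sorted permutations. Cut such a word after its first
  run. If \<open>T\<close> is the set of letters behind the cut, the first run consists of the elements of
  \<open>X - T\<close> in increasing order, and the rest is a flattened word on \<open>T\<close>. Conversely,
  \<open>T \<subseteq> X - {Min X}\<close> and a flattened word on \<open>T\<close> can be glued in this way exactly if there is
  a descent at the cut, that is, if some element of \<open>X - T\<close> exceeds some element of \<open>T\<close>
  (\<open>flattened_perms_first_run\<close>). The number of pairs of this kind is what the cut contributes to
  the inversion number. The inversion generating function of the cuts over all \<open>m\<close>-subsets \<open>T\<close> of
  an \<open>n\<close>-set is the Gaussian binomial coefficient, and for each \<open>m\<close> exactly one \<open>T\<close> gives no
  descent. With \<open>A m\<close> for \<open>A_poly m q 1\<close> and \<open>[n, m]\<close> for the Gaussian binomial coefficient this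
  yields \<open>A (n + 1) = 1 + (\<Sum>m\<le>n. ([n, m] - 1) * A m)\<close> (\<open>A_poly_Suc\<close>), and the difference of two
  consecutive instances is
  \<open>A (n + 2) = (\<Sum>m\<le>n + 1. ([n + 1, m] - [n, m]) * A m)\<close> (\<open>A_poly_Suc_Suc\<close>).

  At \<open>q = -1\<close> the coefficient \<open>[n, m]\<close> vanishes for even \<open>n\<close> and odd \<open>m\<close>, and is the binomial
  coefficient of the halves otherwise. Hence \<open>O n = A (2 n + 1)\<close> and \<open>E n = A (2 n + 2)\<close> satisfy
  \<open>E n = (\<Sum>k\<le>n. (n choose k) * O k)\<close> and
  \<open>O (n + 1) = (\<Sum>k\<le>n. (n choose k) * (E k - O k))\<close>.
  The first identity reduces the claim on \<open>E\<close> to that on \<open>O\<close>. In terms of exponential generating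
  functions the second one reads \<open>O' = e^x (e^x - 1) O\<close>, so that \<open>O = exp ((e^x - 1)^2 / 2)\<close>,
  which enumerates set partitions with a perfect matching of the blocks. The formal argument
  works with coefficients: \<open>matched_partitions_Suc\<close> shows that
  \<open>\<Sum>i. (2 i - 1)!! S(n, 2 i)\<close> satisfies the same recurrence.
\<close>

section \<open>Run starts and flattened words\<close>

text \<open>
  An increasing segment is maximal on the left iff it cannot be extended by one position; a longest
  increasing segment among those starting at such a position is a run.
\<close>

lemma ex_is_run_iff:
  "(\<exists>j. is_run xs i j) \<longleftrightarrow> i < length xs \<and> (i = 0 \<or> xs ! i \<le> xs ! (i - 1))"
proof
  assume "\<exists>j. is_run xs i j"
  then obtain j where j: "is_run xs i j" by blast
  then have seg: "i \<le> j" "j < length xs" "strict_mono_on {i..j} (\<lambda>k. xs ! k)"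
    by (auto simp: is_run_def increasing_segment_def)
  have "xs ! i \<le> xs ! (i - 1)" if "i \<noteq> 0"
  proof (rule ccontr)
    assume lt: "\<not> xs ! i \<le> xs ! (i - 1)"
    have "strict_mono_on {i - 1..j} (\<lambda>k. xs ! k)"
    proof (rule strict_mono_onI)
      fix r s assume rs: "r \<in> {i - 1..j}" "s \<in> {i - 1..j}" "r < s"
      then have s: "s \<in> {i..j}" by auto
      have le: "xs ! i \<le> xs ! s"
        using strict_mono_onD[OF seg(3), of i s] s by (cases "i = s") auto
      show "xs ! r < xs ! s"
      proof (cases "r = i - 1")
        case True then show ?thesis using lt le by simp
      next
        case False then show ?thesis using strict_mono_onD[OF seg(3), of r s] rs s by auto
      qed
    qed
    then have "increasing_segment xs (i - 1) j"
      using seg by (auto simp: increasing_segment_def)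
    then have "i - 1 = i" using j unfolding is_run_def by (meson diff_le_self order_refl)
    then show False using that by simp
  qed
  then show "i < length xs \<and> (i = 0 \<or> xs ! i \<le> xs ! (i - 1))" using seg by auto
next
  assume i: "i < length xs \<and> (i = 0 \<or> xs ! i \<le> xs ! (i - 1))"
  define J where "J = {j. increasing_segment xs i j}"
  have fin: "finite J"
    by (rule finite_subset[of _ "{..<length xs}"]) (auto simp: J_def increasing_segment_def)
  have "i \<in> J" using i by (auto simp: J_def increasing_segment_def strict_mono_on_def)
  then have "Max J \<in> J" using fin Max_in by blast
  moreover have "i' = i \<and> j' = Max J"
    if h: "i' \<le> i" "Max J \<le> j'" "increasing_segment xs i' j'" for i' j'
  proof -
    have le: "i \<le> Max J" using Max_ge[OF fin \<open>i \<in> J\<close>] .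
    have mono: "strict_mono_on {i'..j'} (\<lambda>k. xs ! k)"
      using h by (simp add: increasing_segment_def)
    have "strict_mono_on {i..j'} (\<lambda>k. xs ! k)"
      using mono h(1) by (auto simp: strict_mono_on_def)
    then have "j' \<in> J" using h le by (auto simp: J_def increasing_segment_def)
    then have "j' = Max J" using h(2) Max_ge[OF fin] by (meson antisym)
    moreover have "i' = i"
    proof (rule ccontr)
      assume "i' \<noteq> i"
      then have "i - 1 \<in> {i'..j'}" "i \<in> {i'..j'}" "i - 1 < i" using h(1,2) le by auto
      then have "xs ! (i - 1) < xs ! i" using strict_mono_onD[OF mono] by blast
      then show False using i \<open>i - 1 < i\<close> by auto
    qed
    ultimately show ?thesis by simp
  qed
  ultimately have "is_run xs i (Max J)" by (auto simp: is_run_def J_def)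
  then show "\<exists>j. is_run xs i j" by blast
qed

text \<open>
  The argument \<open>p\<close> is the letter preceding the word, so that a letter \<open>x\<close> starts a run iff it does
  not exceed \<open>p\<close>. In \<open>flattened\<close> the word is preceded by a copy of its own first letter, which
  makes the first position a run start.
\<close>

fun flattened_after :: "nat \<Rightarrow> nat list \<Rightarrow> bool" where
  "flattened_after p [] = True"
| "flattened_after p (x # xs) = ((x \<le> p \<longrightarrow> (\<forall>y\<in>set xs. x < y)) \<and> flattened_after x xs)"

definition flattened :: "nat list \<Rightarrow> bool" where
  "flattened xs = flattened_after (hd xs) xs"

lemma flattened_after_iff:
  "flattened_after p xs \<longleftrightarrow>
     (\<forall>i j. i < j \<and> j < length xs \<and> xs ! i \<le> (p # xs) ! i \<longrightarrow> xs ! i < xs ! j)"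
proof (induction xs arbitrary: p)
  case (Cons x xs)
  have "(\<forall>i j. i < j \<and> j < length (x # xs) \<and> (x # xs) ! i \<le> (p # x # xs) ! i
           \<longrightarrow> (x # xs) ! i < (x # xs) ! j) \<longleftrightarrow>
        (x \<le> p \<longrightarrow> (\<forall>j < length xs. x < xs ! j)) \<and>
        (\<forall>i j. i < j \<and> j < length xs \<and> xs ! i \<le> (x # xs) ! i \<longrightarrow> xs ! i < xs ! j)"
    (is "?L \<longleftrightarrow> ?R")
  proof
    assume L: ?L
    show ?R
    proof (intro conjI allI impI)
      fix j assume "x \<le> p" "j < length xs"
      then show "x < xs ! j" using L[rule_format, of 0 "Suc j"] by simp
    next
      fix i j assume "i < j \<and> j < length xs \<and> xs ! i \<le> (x # xs) ! i"
      then show "xs ! i < xs ! j" using L[rule_format, of "Suc i" "Suc j"] by simp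
    qed
  next
    assume R: ?R
    show ?L
    proof (intro allI impI)
      fix i j assume h: "i < j \<and> j < length (x # xs) \<and> (x # xs) ! i \<le> (p # x # xs) ! i"
      then obtain j' where "j = Suc j'" by (cases j) auto
      then show "(x # xs) ! i < (x # xs) ! j" using h R by (cases i) auto
    qed
  qed
  then show ?case using Cons.IH[of x] by (simp add: all_set_conv_all_nth)
qed simp

lemma flattened_iff:
  "flattened xs \<longleftrightarrow>
     (\<forall>i j. (\<exists>k. is_run xs i k) \<and> i < j \<and> j < length xs \<longrightarrow> xs ! i < xs ! j)"
proof -
  have "xs ! i \<le> (hd xs # xs) ! i \<longleftrightarrow> (\<exists>k. is_run xs i k)" if "i < length xs" for i
    using that by (cases i) (auto simp: ex_is_run_iff hd_conv_nth)
  then show ?thesis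
    unfolding flattened_def flattened_after_iff by (meson order_less_trans)
qed

lemma flattened_hd_less:
  assumes "flattened (x # xs)" "y \<in> set xs"
  shows "x < y"
  using assms by (simp add: flattened_def)

text \<open>
  If the run starts increase, then each letter is at least as large as the start of its own run,
  which exceeds all earlier run starts.
\<close>

lemma run_sorted_iff_flattened:
  assumes xs: "xs \<in> permutations_of_set {1..n}" and n: "n > 0"
  shows "run_sorted xs \<longleftrightarrow> flattened xs"
proof -
  have set: "set xs = {1..n}" using xs by (auto simp: permutations_of_set_def)
  then have ne: "xs \<noteq> []" using n by auto
  show ?thesis
  proof
    assume rs: "run_sorted xs"
    have "xs ! i < xs ! j" if i: "\<exists>k. is_run xs i k" and ij: "i < j" "j < length xs" for i j
      using ij
    proof (induction j)
      case (Suc j)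
      show ?case
      proof (cases "\<exists>k. is_run xs (Suc j) k")
        case True
        then show ?thesis using rs i Suc.prems
          unfolding run_sorted_def by (auto dest: strict_mono_onD)
      next
        case False
        then have "xs ! j < xs ! Suc j" using Suc.prems by (auto simp: ex_is_run_iff)
        moreover have "xs ! i \<le> xs ! j"
          using Suc by (cases "i = j") auto
        ultimately show ?thesis by simp
      qed
    qed simp
    then show "flattened xs" by (auto simp: flattened_iff)
  next
    assume fl: "flattened xs"
    obtain y ys where y: "xs = y # ys" using ne by (cases xs) auto
    have "1 \<in> set xs" using set n by simp
    moreover have "y \<ge> 1" using set y by (metis atLeastAtMost_iff list.set_intros(1))
    ultimately have "hd xs = 1" using y fl flattened_hd_less[of y ys 1] by auto
    moreover have "strict_mono_on {i. \<exists>j. is_run xs i j} (\<lambda>i. xs ! i)"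
    proof (rule strict_mono_onI)
      fix r s assume "r \<in> {i. \<exists>j. is_run xs i j}" "s \<in> {i. \<exists>j. is_run xs i j}" "r < s"
      moreover from this have "s < length xs" by (auto simp: ex_is_run_iff)
      ultimately show "xs ! r < xs ! s" using fl by (auto simp: flattened_iff)
    qed
    ultimately show "run_sorted xs" using ne by (simp add: run_sorted_def)
  qed
qed

lemma flattened_after_append_increasing:
  assumes "sorted_wrt (<) (p # ys)"
  shows "flattened_after p (ys @ zs) \<longleftrightarrow> flattened_after (last (p # ys)) zs"
  using assms by (induction ys arbitrary: p) auto

text \<open>
  When \<open>ys\<close> is the first run of \<open>ys @ zs\<close>, the runs of the word are \<open>ys\<close> and the runs of \<open>zs\<close>.
\<close>

lemma flattened_append_iff:
  assumes "sorted_wrt (<) ys" "ys \<noteq> []" "zs \<noteq> [] \<Longrightarrow> hd zs \<le> last ys"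
  shows "flattened (ys @ zs) \<longleftrightarrow> (\<forall>z\<in>set zs. hd ys < z) \<and> flattened zs"
proof -
  obtain p ys' where ys: "ys = p # ys'" using assms(2) by (cases ys) auto
  have "flattened (ys @ zs) \<longleftrightarrow> (\<forall>z\<in>set (ys' @ zs). p < z) \<and> flattened_after p (ys' @ zs)"
    by (simp add: ys flattened_def)
  also have "flattened_after p (ys' @ zs) \<longleftrightarrow> flattened_after (last ys) zs"
    using flattened_after_append_increasing assms(1) by (simp add: ys)
  also have "flattened_after (last ys) zs \<longleftrightarrow> flattened zs"
    using assms(3) by (cases zs) (auto simp: flattened_def)
  finally show ?thesis using assms(1) by (auto simp: ys)
qed

lemma ex_first_run:
  fixes xs :: "'a::linorder list"
  assumes "xs \<noteq> []"
  shows "\<exists>ys zs. xs = ys @ zs \<and> ys \<noteq> [] \<and> sorted_wrt (<) ys \<and> (zs \<noteq> [] \<longrightarrow> hd zs \<le> last ys)"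
  using assms
proof (induction xs)
  case (Cons x xs)
  show ?case
  proof (cases "xs = [] \<or> hd xs \<le> x")
    case True
    then have "x # xs = [x] @ xs \<and> [x] \<noteq> [] \<and> sorted_wrt (<) [x] \<and> (xs \<noteq> [] \<longrightarrow> hd xs \<le> last [x])"
      by auto
    then show ?thesis by blast
  next
    case False
    with Cons.IH obtain ys zs where h: "xs = ys @ zs" "ys \<noteq> []" "sorted_wrt (<) ys"
      "zs \<noteq> [] \<longrightarrow> hd zs \<le> last ys" by auto
    have "hd xs = hd ys" using h(1,2) by simp
    with False have "x < hd ys" by auto
    then have "sorted_wrt (<) (x # ys)" using h(2,3) by (cases ys) auto
    then have "x # xs = (x # ys) @ zs \<and> x # ys \<noteq> [] \<and> sorted_wrt (<) (x # ys) \<and>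
        (zs \<noteq> [] \<longrightarrow> hd zs \<le> last (x # ys))"
      using h by simp
    then show ?thesis by blast
  qed
qed simp

text \<open>
  Of two different prefixes the longer one would contain the descent that ends the shorter one.
\<close>

lemma first_run_unique:
  fixes ys :: "'a::linorder list"
  assumes "ys @ zs = ys' @ zs'" "sorted_wrt (<) ys" "sorted_wrt (<) ys'" "ys \<noteq> []" "ys' \<noteq> []"
    and "zs \<noteq> [] \<Longrightarrow> hd zs \<le> last ys" "zs' \<noteq> [] \<Longrightarrow> hd zs' \<le> last ys'"
  shows "ys = ys' \<and> zs = zs'"
proof -
  have no_ext: False
    if "sorted_wrt (<) (us @ ws)" "us \<noteq> []" "ws \<noteq> []" "hd (ws @ vs) \<le> last us"
    for us vs ws :: "'a list"
  proof -
    have "last us \<in> set us" "hd ws \<in> set ws" using that by auto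
    then have "last us < hd ws" using that(1) by (auto simp: sorted_wrt_append)
    then show False using that by simp
  qed
  from assms(1) obtain ws where "ys = ys' @ ws \<and> ws @ zs = zs' \<or> ys @ ws = ys' \<and> zs = ws @ zs'"
    by (auto simp: append_eq_append_conv2)
  then show ?thesis
  proof
    assume h: "ys = ys' @ ws \<and> ws @ zs = zs'"
    then have "ws = []" using no_ext[of ys' ws zs] assms by (cases "ws = []") auto
    then show ?thesis using h by simp
  next
    assume h: "ys @ ws = ys' \<and> zs = ws @ zs'"
    then have "ws = []" using no_ext[of ys ws zs'] assms by (cases "ws = []") auto
    then show ?thesis using h by simp
  qed
qed

section \<open>Inversions of a concatenation\<close>

definition cross_inv :: "'a::linorder set \<Rightarrow> 'a set \<Rightarrow> nat" where
  "cross_inv S T = card {(s, t). s \<in> S \<and> t \<in> T \<and> t < s}"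

lemma finite_cross_inv:
  assumes "finite S" "finite T"
  shows "finite {(s, t). s \<in> S \<and> t \<in> T \<and> t < (s :: 'a::linorder)}"
  by (rule finite_subset[of _ "S \<times> T"]) (use assms in auto)

lemma cross_inv_eq_0_iff:
  assumes "finite S" "finite T"
  shows "cross_inv S T = 0 \<longleftrightarrow> (\<forall>s\<in>S. \<forall>t\<in>T. s \<le> t)"
  using finite_cross_inv[OF assms] by (auto simp: cross_inv_def not_less)

lemma cross_inv_insert_left:
  assumes "finite S" "finite T" "x \<notin> S"
  shows "cross_inv (insert x S) T = card {t\<in>T. t < x} + cross_inv S T"
proof -
  have "{(s, t). s \<in> insert x S \<and> t \<in> T \<and> t < s} =
      Pair x ` {t\<in>T. t < x} \<union> {(s, t). s \<in> S \<and> t \<in> T \<and> t < s}" by auto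
  moreover have "card (Pair x ` {t\<in>T. t < x}) = card {t\<in>T. t < x}"
    by (intro card_image inj_onI) auto
  moreover have "Pair x ` {t\<in>T. t < x} \<inter> {(s, t). s \<in> S \<and> t \<in> T \<and> t < s} = {}"
    using assms(3) by auto
  ultimately show ?thesis
    unfolding cross_inv_def using assms finite_cross_inv[OF assms(1,2)]
    by (simp add: card_Un_disjoint)
qed

lemma inversions_Cons:
  "inversions (x # xs) = length (filter (\<lambda>y. y < x) xs) + inversions xs"
proof -
  let ?I = "{(i, j). i < j \<and> j < length xs \<and> xs ! i > xs ! j}"
  let ?J = "{j. j < length xs \<and> xs ! j < x}"
  have "{(i, j). i < j \<and> j < length (x # xs) \<and> (x # xs) ! i > (x # xs) ! j} =
      (\<lambda>j. (0, Suc j)) ` ?J \<union> map_prod Suc Suc ` ?I" (is "?L = ?R")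
  proof (intro equalityI subsetI)
    fix p assume "p \<in> ?L"
    then obtain i j where p: "p = (i, j)" "i < j" "j < length (x # xs)" "(x # xs) ! i > (x # xs) ! j"
      by auto
    then obtain j' where j: "j = Suc j'" by (cases j) auto
    show "p \<in> ?R"
    proof (cases i)
      case 0
      then show ?thesis using p j by auto
    next
      case (Suc i')
      then have "(i', j') \<in> ?I" using p j by auto
      then have "map_prod Suc Suc (i', j') \<in> map_prod Suc Suc ` ?I" by (rule imageI)
      then show ?thesis using p(1) j Suc by simp
    qed
  qed auto
  moreover have "card ((\<lambda>j. (0::nat, Suc j)) ` ?J) = card ?J"
    by (intro card_image inj_onI) auto
  moreover have "card (map_prod Suc Suc ` ?I) = card ?I"
    by (intro card_image inj_onI) auto
  moreover have "finite ?I"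
    by (rule finite_subset[of _ "{..<length xs} \<times> {..<length xs}"]) auto
  moreover have "(\<lambda>j. (0, Suc j)) ` ?J \<inter> map_prod Suc Suc ` ?I = {}" by auto
  ultimately show ?thesis
    by (simp add: inversions_def length_filter_conv_card card_Un_disjoint)
qed

lemma inversions_append:
  assumes "distinct ys" "distinct zs"
  shows "inversions (ys @ zs) = inversions ys + inversions zs + cross_inv (set ys) (set zs)"
  using assms(1)
proof (induction ys)
  case Nil
  show ?case by (simp add: inversions_def cross_inv_def)
next
  case (Cons y ys)
  have "length (filter (\<lambda>z. z < y) zs) = card {z\<in>set zs. z < y}"
    using assms(2) by (metis distinct_card distinct_filter set_filter)
  then show ?case
    using Cons by (simp add: inversions_Cons cross_inv_insert_left)
qed

lemma inversions_increasing:
  assumes "sorted_wrt (<) xs"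
  shows "inversions xs = 0"
proof -
  have "{(i, j). i < j \<and> j < length xs \<and> xs ! i > xs ! j} = {}"
    using assms by (force simp: sorted_wrt_iff_nth_less)
  then show ?thesis unfolding inversions_def by (metis card.empty)
qed

section \<open>Gaussian binomial coefficients\<close>

fun gauss_binomial :: "'a::comm_ring_1 \<Rightarrow> nat \<Rightarrow> nat \<Rightarrow> 'a" where
  "gauss_binomial q n 0 = 1"
| "gauss_binomial q 0 (Suc k) = 0"
| "gauss_binomial q (Suc n) (Suc k) =
     gauss_binomial q n k + q ^ Suc k * gauss_binomial q n (Suc k)"

lemma gauss_binomial_eq_0: "n < k \<Longrightarrow> gauss_binomial q n k = 0"
  by (induction q n k rule: gauss_binomial.induct) auto

lemma sum_Pow_insert:
  assumes "finite Y" "y \<notin> Y"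
  shows "(\<Sum>T\<in>Pow (insert y Y). f T) = (\<Sum>T\<in>Pow Y. f T + f (insert y T))"
proof -
  have "inj_on (insert y) (Pow Y)"
    using assms(2) by (intro inj_onI) (auto dest: insert_ident[THEN iffD1, rotated 2])
  moreover have "Pow Y \<inter> insert y ` Pow Y = {}" using assms(2) by auto
  ultimately show ?thesis
    using assms by (simp add: Pow_insert sum.union_disjoint sum.reindex sum.distrib)
qed

text \<open>
  The induction removes the largest element \<open>y\<close>. If \<open>y\<close> lies in \<open>T\<close>, it belongs to no inverted
  pair; otherwise it forms one with each element of \<open>T\<close>. These two cases are the two terms of
  the recurrence of the Gaussian binomial coefficients. The weight \<open>f\<close> is arbitrary because the
  induction hypothesis is needed for \<open>\<lambda>m. q ^ m * f m\<close> and for \<open>\<lambda>m. f (Suc m)\<close>.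
\<close>

lemma sum_cross_inv_eq_gauss_binomial:
  fixes q :: "'b::comm_ring_1" and Y :: "'a::linorder set"
  assumes "finite Y"
  shows "(\<Sum>T\<in>Pow Y. q ^ cross_inv (Y - T) T * f (card T)) =
         (\<Sum>m\<le>card Y. gauss_binomial q (card Y) m * f m)"
  using assms
proof (induction Y arbitrary: f rule: finite_linorder_max_induct)
  case empty
  then show ?case by (simp add: cross_inv_def)
next
  case (insert y Y)
  let ?N = "card Y"
  have y: "y \<notin> Y" using insert.hyps(2) by auto
  have low: "cross_inv (insert y Y - T) T = card T + cross_inv (Y - T) T" if "T \<subseteq> Y" for T
  proof -
    have "insert y Y - T = insert y (Y - T)" using that y by auto
    moreover have "{t\<in>T. t < y} = T" using that insert.hyps(2) by auto
    ultimately show ?thesis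
      using that y insert.hyps(1) by (simp add: cross_inv_insert_left finite_subset)
  qed
  have high: "cross_inv (insert y Y - insert y T) (insert y T) = cross_inv (Y - T) T"
    if "T \<subseteq> Y" for T
  proof -
    have "{(s, t). s \<in> insert y Y - insert y T \<and> t \<in> insert y T \<and> t < s} =
        {(s, t). s \<in> Y - T \<and> t \<in> T \<and> t < s}"
      using y insert.hyps(2) by auto
    then show ?thesis by (simp add: cross_inv_def)
  qed
  have "(\<Sum>T\<in>Pow (insert y Y). q ^ cross_inv (insert y Y - T) T * f (card T)) =
      (\<Sum>T\<in>Pow Y. q ^ cross_inv (Y - T) T * (q ^ card T * f (card T))
                 + q ^ cross_inv (Y - T) T * f (Suc (card T)))"
    unfolding sum_Pow_insert[OF insert.hyps(1) y]
  proof (intro sum.cong refl)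
    fix T assume "T \<in> Pow Y"
    then have T: "T \<subseteq> Y" by simp
    then have card: "card (insert y T) = Suc (card T)"
      using y insert.hyps(1) by (meson card_insert_disjoint finite_subset subsetD)
    then show "q ^ cross_inv (insert y Y - T) T * f (card T) +
        q ^ cross_inv (insert y Y - insert y T) (insert y T) * f (card (insert y T)) =
        q ^ cross_inv (Y - T) T * (q ^ card T * f (card T))
          + q ^ cross_inv (Y - T) T * f (Suc (card T))"
      unfolding low[OF T] high[OF T] card by (simp add: power_add mult_ac)
  qed
  also have "\<dots> = (\<Sum>m\<le>?N. gauss_binomial q ?N m * (q ^ m * f m)) +
      (\<Sum>m\<le>?N. gauss_binomial q ?N m * f (Suc m))"
    unfolding sum.distrib
    using insert.IH[of "\<lambda>m. q ^ m * f m"] insert.IH[of "\<lambda>m. f (Suc m)"] by simp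
  also have "(\<Sum>m\<le>?N. gauss_binomial q ?N m * (q ^ m * f m)) =
      (\<Sum>m\<le>Suc ?N. gauss_binomial q ?N m * (q ^ m * f m))"
    by (simp add: gauss_binomial_eq_0)
  also have "\<dots> = f 0 + (\<Sum>m\<le>?N. gauss_binomial q ?N (Suc m) * (q ^ Suc m * f (Suc m)))"
    by (subst sum.atMost_Suc_shift) simp
  also have "\<dots> + (\<Sum>m\<le>?N. gauss_binomial q ?N m * f (Suc m)) =
      (\<Sum>m\<le>Suc ?N. gauss_binomial q (Suc ?N) m * f m)"
    by (subst sum.atMost_Suc_shift) (simp add: algebra_simps sum.distrib)
  finally show ?case using insert.hyps(1) y by simp
qed

text \<open>
  Without an inverted pair \<open>T\<close> consists of the largest elements of \<open>Y\<close>, so there is exactly one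
  such \<open>T\<close> of each cardinality.
\<close>

lemma sum_cross_inv_eq_0:
  fixes f :: "nat \<Rightarrow> 'b::comm_monoid_add" and Y :: "'a::linorder set"
  assumes "finite Y"
  shows "(\<Sum>T | T \<subseteq> Y \<and> cross_inv (Y - T) T = 0. f (card T)) = (\<Sum>m\<le>card Y. f m)"
  using assms
proof (induction Y rule: finite_linorder_min_induct)
  case empty
  have "{T. T \<subseteq> {} \<and> cross_inv ({} - T) T = 0} = {{} :: 'a set}" by (auto simp: cross_inv_def)
  then show ?case by simp
next
  case (insert y Y)
  let ?U = "\<lambda>Y. {T. T \<subseteq> Y \<and> cross_inv (Y - T) T = 0}"
  have y: "y \<notin> Y" using insert.hyps(2) by auto
  have U: "?U Z = {T. T \<subseteq> Z \<and> (\<forall>s\<in>Z - T. \<forall>t\<in>T. s \<le> t)}" if "finite Z" for Z :: "'a set"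
    using that by (auto simp: cross_inv_eq_0_iff finite_subset)
  have "?U (insert y Y) = insert (insert y Y) (?U Y)" (is "?L = ?R")
  proof (intro equalityI subsetI)
    fix T assume "T \<in> ?L"
    then have T: "T \<subseteq> insert y Y" "\<forall>s\<in>insert y Y - T. \<forall>t\<in>T. s \<le> t"
      using U insert.hyps(1) by auto
    show "T \<in> ?R"
    proof (cases "y \<in> T")
      case True
      then have "Y - T = {}" using T(2) insert.hyps(2) y by (auto simp: not_le[symmetric])
      then have "T = insert y Y" using T(1) True by auto
      then show ?thesis by simp
    next
      case False
      then have "T \<in> ?U Y" using T U[OF insert.hyps(1)] by auto
      then show ?thesis by simp
    qed
  next
    fix T assume "T \<in> ?R"
    then have "T = insert y Y \<or> T \<subseteq> Y \<and> (\<forall>s\<in>Y - T. \<forall>t\<in>T. s \<le> t)"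
      using U[OF insert.hyps(1)] by auto
    then have "T \<subseteq> insert y Y \<and> (\<forall>s\<in>insert y Y - T. \<forall>t\<in>T. s \<le> t)"
      using insert.hyps(2) by fastforce
    then show "T \<in> ?L" using U[of "insert y Y"] insert.hyps(1) by auto
  qed
  moreover have "insert y Y \<notin> ?U Y" using y by auto
  moreover have "finite (?U Y)" using insert.hyps(1) by simp
  ultimately show ?case using insert.IH insert.hyps(1) y by (simp add: add.commute)
qed


lemma gauss_binomial_minus_one:
  "gauss_binomial (- 1 :: 'a::comm_ring_1) n k =
     (if even n \<and> odd k then 0 else of_nat ((n div 2) choose (k div 2)))"
proof (induction n arbitrary: k)
  case 0
  show ?case by (cases k) (auto elim: oddE simp: binomial_eq_0)
next
  case (Suc n)
  show ?case
  proof (cases k)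
    case (Suc m)
    then show ?thesis
      using Suc.IH
      by (cases "even n"; cases "even m") (auto elim!: evenE oddE)
  qed simp
qed

section \<open>Removing the first run\<close>

definition flattened_perms :: "nat set \<Rightarrow> nat list set" where
  "flattened_perms X = {xs \<in> permutations_of_set X. flattened xs}"

lemma finite_flattened_perms [simp]: "finite X \<Longrightarrow> finite (flattened_perms X)"
  by (simp add: flattened_perms_def)

lemma flattened_perms_iff:
  "xs \<in> flattened_perms X \<longleftrightarrow> set xs = X \<and> distinct xs \<and> flattened xs"
  by (auto simp: flattened_perms_def permutations_of_set_def)

text \<open>
  The last letter of an increasing word is its maximum and the first letter of a flattened word is
  its minimum, so a descent at the cut is the same as an inverted pair across the cut.
\<close>

lemma descent_iff_cross_inv:
  assumes ys: "sorted_wrt (<) ys" "ys \<noteq> []" and zs: "flattened zs" "zs \<noteq> []"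
    and disj: "set ys \<inter> set zs = {}"
  shows "hd zs \<le> last ys \<longleftrightarrow> cross_inv (set ys) (set zs) \<noteq> 0"
proof -
  have least: "hd zs \<le> z" if "z \<in> set zs" for z
    using that zs flattened_hd_less by (cases zs) (auto intro: less_imp_le)
  have greatest: "y \<le> last ys" if "y \<in> set ys" for y
  proof -
    have "ys = butlast ys @ [last ys]" using ys(2) by simp
    then have "sorted_wrt (<) (butlast ys @ [last ys])" "y \<in> set (butlast ys @ [last ys])"
      using ys(1) that by simp_all
    then show ?thesis by (auto simp: sorted_wrt_append)
  qed
  have "hd zs \<noteq> last ys" using disj ys(2) zs(2) by (metis disjoint_iff hd_in_set last_in_set)
  then have "hd zs \<le> last ys \<longleftrightarrow> hd zs < last ys" by auto
  also have "\<dots> \<longleftrightarrow> (\<exists>s\<in>set ys. \<exists>t\<in>set zs. t < s)"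
    using least greatest ys(2) zs(2)
    by (meson hd_in_set last_in_set le_less_trans less_le_trans)
  also have "\<dots> \<longleftrightarrow> cross_inv (set ys) (set zs) \<noteq> 0"
    by (auto simp: cross_inv_eq_0_iff not_le)
  finally show ?thesis .
qed

text \<open>
  The word with a single run stands apart, since for it nothing remains behind the cut.
\<close>

lemma flattened_perms_first_run:
  assumes X: "finite X" "X \<noteq> {}"
  shows "flattened_perms X = insert (sorted_list_of_set X)
     ((\<lambda>(T, zs). sorted_list_of_set (X - T) @ zs) `
       (SIGMA T:{T. T \<subseteq> X - {Min X} \<and> cross_inv (X - T) T \<noteq> 0}. flattened_perms T))"
    (is "_ = insert _ (?h ` Sigma ?I _)")
proof (intro equalityI subsetI)
  fix xs assume xs: "xs \<in> flattened_perms X"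
  then have set: "set xs = X" and dist: "distinct xs" and fl: "flattened xs"
    by (auto simp: flattened_perms_iff)
  then have "xs \<noteq> []" using X by auto
  then obtain ys zs where h: "xs = ys @ zs" "ys \<noteq> []" "sorted_wrt (<) ys"
    "zs \<noteq> [] \<longrightarrow> hd zs \<le> last ys"
    using ex_first_run by blast
  have ys: "ys = sorted_list_of_set (set ys)"
    using h(3) by (simp add: sorted_list_of_set.idem_if_sorted_distinct strict_sorted_iff)
  have flz: "\<forall>z\<in>set zs. hd ys < z" "flattened zs"
    using fl h by (simp_all add: flattened_append_iff)
  show "xs \<in> insert (sorted_list_of_set X) (?h ` Sigma ?I flattened_perms)"
  proof (cases "zs = []")
    case True
    then show ?thesis using h(1) ys set by simp
  next
    case False
    have disj: "set ys \<inter> set zs = {}" using dist h(1) by auto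
    then have diff: "X - set zs = set ys" using set h(1) by auto
    have "Min X \<le> hd ys" using X h set by (intro Min_le) auto
    then have "set zs \<subseteq> X - {Min X}" using flz(1) set h(1) by fastforce
    moreover have "cross_inv (X - set zs) (set zs) \<noteq> 0"
      using descent_iff_cross_inv[OF h(3,2) flz(2) False disj] h(4) False diff by simp
    moreover have "zs \<in> flattened_perms (set zs)"
      using flz(2) dist h(1) by (simp add: flattened_perms_iff)
    moreover have "xs = ?h (set zs, zs)" using h(1) ys diff by simp
    ultimately show ?thesis by blast
  qed
next
  fix xs assume "xs \<in> insert (sorted_list_of_set X) (?h ` Sigma ?I flattened_perms)"
  then consider "xs = sorted_list_of_set X"
    | T zs where "T \<in> ?I" "zs \<in> flattened_perms T" "xs = sorted_list_of_set (X - T) @ zs"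
    by auto
  then show "xs \<in> flattened_perms X"
  proof cases
    case 1
    have "flattened (sorted_list_of_set X @ [])"
      using X by (subst flattened_append_iff) (auto simp: flattened_def)
    then show ?thesis using X 1 by (simp add: flattened_perms_iff)
  next
    case 2
    let ?ys = "sorted_list_of_set (X - T)"
    have T: "T \<subseteq> X" "Min X \<notin> T" "cross_inv (X - T) T \<noteq> 0" using 2(1) by auto
    have Min: "Min X \<in> X - T" using X T by simp
    have ys: "set ?ys = X - T" "sorted_wrt (<) ?ys" using X by auto
    have ne: "?ys \<noteq> []" using ys(1) Min by auto
    have zs: "set zs = T" "distinct zs" "flattened zs" using 2(2) by (auto simp: flattened_perms_iff)
    have "zs \<noteq> [] \<Longrightarrow> hd zs \<le> last ?ys"
      using descent_iff_cross_inv[OF ys(2) ne zs(3)] T(3) ys(1) zs(1) by auto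
    moreover have "hd ?ys < z" if "z \<in> T" for z
    proof -
      obtain y ys' where y: "?ys = y # ys'" using ne by (cases ?ys) auto
      have "y \<le> Min X"
        using ys Min y by (metis list.inject list.set_cases order.strict_implies_order order_refl
            set_ConsD sorted_wrt.simps(2))
      moreover have "Min X \<le> z" "Min X \<noteq> z" using X T that by auto
      ultimately show ?thesis using y by simp
    qed
    ultimately have "flattened (?ys @ zs)"
      using ys ne zs by (subst flattened_append_iff) auto
    then show ?thesis using 2(3) zs ys X T by (auto simp: flattened_perms_iff)
  qed
qed

definition flattened_sum :: "'a::comm_ring_1 \<Rightarrow> nat set \<Rightarrow> 'a" where
  "flattened_sum q X = (\<Sum>xs\<in>flattened_perms X. q ^ inversions xs)"

text \<open>
  The minimum of \<open>X\<close> always lies in the first run and is in no inverted pair, so the cut can be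
  described by subsets of \<open>Y\<close> alone.
\<close>

lemma flattened_sum_first_run:
  assumes X: "finite X" "X \<noteq> {}"
  defines "Y \<equiv> X - {Min X}"
  shows "flattened_sum q X =
     1 + (\<Sum>T | T \<subseteq> Y \<and> cross_inv (Y - T) T \<noteq> 0. q ^ cross_inv (Y - T) T * flattened_sum q T)"
proof -
  let ?I = "{T. T \<subseteq> Y \<and> cross_inv (X - T) T \<noteq> 0}"
  let ?h = "\<lambda>(T, zs). sorted_list_of_set (X - T) @ zs"
  have cross: "cross_inv (X - T) T = cross_inv (Y - T) T" if "T \<subseteq> Y" for T
  proof -
    have "X - T = insert (Min X) (Y - T)" using Min_in[OF X] that unfolding Y_def by blast
    moreover have "\<not> t < Min X" if "t \<in> T" for t
      using X \<open>T \<subseteq> Y\<close> that by (auto simp: Y_def not_less)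
    then have "{t\<in>T. t < Min X} = {}" by auto
    ultimately show ?thesis
      using X that by (simp add: cross_inv_insert_left Y_def finite_subset)
  qed
  have finY: "finite Y" "Y \<subseteq> X" using X by (auto simp: Y_def)
  have finI: "finite ?I" using finY by simp
  have finT: "finite T" if "T \<in> ?I" for T using that finY by (auto intro: finite_subset)
  have zs: "zs \<noteq> []" "flattened zs" "set zs = T" "distinct zs" "T \<subseteq> X" "X - T \<noteq> {}"
    "hd zs \<le> last (sorted_list_of_set (X - T))"
    if "T \<in> ?I" "zs \<in> flattened_perms T" for T zs
  proof -
    show fl: "flattened zs" and set: "set zs = T" and "distinct zs"
      using that(2) by (auto simp: flattened_perms_iff)
    show "T \<subseteq> X" using that(1) finY by auto
    have Min: "Min X \<in> X - T" using that(1) X by (auto simp: Y_def)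
    then show "X - T \<noteq> {}" by auto
    have "T \<noteq> {}" using that(1) by (auto simp: cross_inv_def)
    then show "zs \<noteq> []" using set by auto
    moreover have "set (sorted_list_of_set (X - T)) = X - T" using X by simp
    moreover from this have "sorted_list_of_set (X - T) \<noteq> []" using Min by auto
    ultimately show "hd zs \<le> last (sorted_list_of_set (X - T))"
      using descent_iff_cross_inv[of "sorted_list_of_set (X - T)" zs] fl set that(1) by auto
  qed
  have inj: "inj_on ?h (Sigma ?I flattened_perms)"
  proof (rule inj_onI)
    fix p p' assume p: "p \<in> Sigma ?I flattened_perms" "p' \<in> Sigma ?I flattened_perms" "?h p = ?h p'"
    obtain T zs T' zs' where pp: "p = (T, zs)" "p' = (T', zs')" by (metis surj_pair)
    have h: "T \<in> ?I" "zs \<in> flattened_perms T" "T' \<in> ?I" "zs' \<in> flattened_perms T'"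
      "sorted_list_of_set (X - T) @ zs = sorted_list_of_set (X - T') @ zs'"
      using p pp by auto
    note z = zs[OF h(1,2)] and z' = zs[OF h(3,4)]
    have "sorted_list_of_set (X - T) \<noteq> []" "sorted_list_of_set (X - T') \<noteq> []"
      using z(6) z'(6) X by simp_all
    then have "zs = zs'"
      using first_run_unique[OF h(5) _ _ _ _ z(7) z'(7)] by simp
    then show "p = p'" using pp z(3) z'(3) by simp
  qed
  have notin: "sorted_list_of_set X \<notin> ?h ` Sigma ?I flattened_perms"
  proof
    assume "sorted_list_of_set X \<in> ?h ` Sigma ?I flattened_perms"
    then obtain T zs where T: "T \<in> ?I" "zs \<in> flattened_perms T"
      and eq: "sorted_list_of_set X = sorted_list_of_set (X - T) @ zs" by auto
    have "sorted_wrt (<) (sorted_list_of_set (X - T) @ zs)" unfolding eq[symmetric] by simp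
    moreover have "last (sorted_list_of_set (X - T)) \<in> set (sorted_list_of_set (X - T))"
      using zs(6)[OF T] X by (intro last_in_set) auto
    moreover have "hd zs \<in> set zs" using zs(1)[OF T] by simp
    ultimately have "last (sorted_list_of_set (X - T)) < hd zs"
      unfolding sorted_wrt_append by blast
    then show False using zs(7)[OF T] by simp
  qed
  have finS: "finite (Sigma ?I flattened_perms)"
    using finI finT by (intro finite_SigmaI) auto
  have "flattened_sum q X = q ^ inversions (sorted_list_of_set X) +
      (\<Sum>xs\<in>?h ` Sigma ?I flattened_perms. q ^ inversions xs)"
    unfolding flattened_sum_def flattened_perms_first_run[OF X] Y_def[symmetric]
    by (rule sum.insert) (use finS notin in auto)
  also have "inversions (sorted_list_of_set X) = 0"
    by (intro inversions_increasing) simp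
  also have "(\<Sum>xs\<in>?h ` Sigma ?I flattened_perms. q ^ inversions xs) =
      (\<Sum>p\<in>Sigma ?I flattened_perms. q ^ inversions (?h p))"
    unfolding sum.reindex[OF inj] comp_def ..
  also have "\<dots> = (\<Sum>T\<in>?I. \<Sum>zs\<in>flattened_perms T. q ^ inversions (sorted_list_of_set (X - T) @ zs))"
    by (subst sum.Sigma) (use finI finT in \<open>auto intro!: sum.cong\<close>)
  also have "\<dots> = (\<Sum>T\<in>?I. q ^ cross_inv (Y - T) T * flattened_sum q T)"
  proof (rule sum.cong[OF refl])
    fix T assume T: "T \<in> ?I"
    have "q ^ inversions (sorted_list_of_set (X - T) @ zs) =
        q ^ cross_inv (Y - T) T * q ^ inversions zs" if "zs \<in> flattened_perms T" for zs
    proof -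
      have "inversions (sorted_list_of_set (X - T)) = 0"
        by (intro inversions_increasing) simp
      then show ?thesis
        using zs[OF T that] T X cross[of T] by (simp add: inversions_append power_add)
    qed
    then show "(\<Sum>zs\<in>flattened_perms T. q ^ inversions (sorted_list_of_set (X - T) @ zs)) =
        q ^ cross_inv (Y - T) T * flattened_sum q T"
      by (simp add: flattened_sum_def sum_distrib_left)
  qed
  also have "?I = {T. T \<subseteq> Y \<and> cross_inv (Y - T) T \<noteq> 0}" using cross by auto
  finally show ?thesis by simp
qed

section \<open>The recurrence\<close>

text \<open>
  The sum over all \<open>T\<close> with a descent at the cut is the sum over all \<open>T\<close>, which produces the
  Gaussian binomial coefficients, minus the sum over those without descent, which produces the
  \<open>- 1\<close>. The empty set has no descent, so the term \<open>m = 0\<close> vanishes; this is why \<open>f\<close> is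
  compared with \<open>flattened_sum q\<close> on nonempty sets only.
\<close>

lemma flattened_sum_card:
  assumes X: "finite X" "X \<noteq> {}"
    and f: "\<And>T. T \<subset> X \<Longrightarrow> T \<noteq> {} \<Longrightarrow> flattened_sum q T = f (card T)"
  shows "flattened_sum q X = 1 + (\<Sum>m\<le>card X - 1. (gauss_binomial q (card X - 1) m - 1) * f m)"
proof -
  define Y where "Y = X - {Min X}"
  have Y: "finite Y" "card Y = card X - 1" "Y \<subset> X"
    using X(1) Min_in[OF X] unfolding Y_def by (simp_all add: psubset_eq) blast
  let ?w = "\<lambda>T. q ^ cross_inv (Y - T) T * f (card T)"
  have "(\<Sum>T | T \<subseteq> Y \<and> cross_inv (Y - T) T \<noteq> 0. q ^ cross_inv (Y - T) T * flattened_sum q T) =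
      (\<Sum>T | T \<subseteq> Y \<and> cross_inv (Y - T) T \<noteq> 0. ?w T)"
  proof (rule sum.cong[OF refl])
    fix T assume "T \<in> {T. T \<subseteq> Y \<and> cross_inv (Y - T) T \<noteq> 0}"
    then have "T \<subset> X" "T \<noteq> {}" using Y by (auto simp: cross_inv_def)
    then show "q ^ cross_inv (Y - T) T * flattened_sum q T = ?w T" using f by simp
  qed
  also have "\<dots> = (\<Sum>T\<in>Pow Y - {T. T \<subseteq> Y \<and> cross_inv (Y - T) T = 0}. ?w T)"
    by (rule sum.cong) auto
  also have "\<dots> = (\<Sum>T\<in>Pow Y. ?w T) - (\<Sum>T | T \<subseteq> Y \<and> cross_inv (Y - T) T = 0. ?w T)"
    using Y by (intro sum_diff) auto
  also have "(\<Sum>T | T \<subseteq> Y \<and> cross_inv (Y - T) T = 0. ?w T) =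
      (\<Sum>T | T \<subseteq> Y \<and> cross_inv (Y - T) T = 0. f (card T))"
    by (rule sum.cong) auto
  also have "\<dots> = (\<Sum>m\<le>card Y. f m)" by (rule sum_cross_inv_eq_0[OF Y(1)])
  also have "(\<Sum>T\<in>Pow Y. ?w T) = (\<Sum>m\<le>card Y. gauss_binomial q (card Y) m * f m)"
    by (rule sum_cross_inv_eq_gauss_binomial[OF Y(1)])
  finally show ?thesis
    using flattened_sum_first_run[OF X, of q] Y
    by (simp add: Y_def[symmetric] algebra_simps sum_subtractf)
qed

lemma A_poly_eq_flattened_sum:
  assumes "n > 0"
  shows "A_poly n q 1 = flattened_sum q {1..n}"
proof -
  have "run_sorted_perms n = flattened_perms {1..n}"
    using run_sorted_iff_flattened[OF _ assms]
    by (auto simp: run_sorted_perms_def flattened_perms_def)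
  then show ?thesis by (simp add: A_poly_def flattened_sum_def)
qed

text \<open>
  The recurrence expresses the sum for \<open>X\<close> through \<open>card X\<close>, so by induction it has the same value
  for all sets of the same size. This replaces relabelling the letters of a word.
\<close>

lemma flattened_sum_eq_A_poly:
  assumes "finite X" "X \<noteq> {}"
  shows "flattened_sum q X = A_poly (card X) q 1"
  using assms
proof (induction "card X" arbitrary: X rule: less_induct)
  case less
  have IH: "flattened_sum q T = A_poly (card T) q 1"
    if "T \<subset> Z" "T \<noteq> {}" "finite Z" "card Z = card X" for T Z
    using less.hyps[of T] that by (metis finite_subset psubset_card_mono psubset_imp_subset)
  have pos: "card X > 0" using less.prems by (simp add: card_gt_0_iff)
  have "flattened_sum q X = flattened_sum q {1..card X}"
    using flattened_sum_card[of X q "\<lambda>m. A_poly m q 1"] less.prems pos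
      flattened_sum_card[of "{1..card X}" q "\<lambda>m. A_poly m q 1"]
      IH[of _ X] IH[of _ "{1..card X}"] by simp
  then show ?case using A_poly_eq_flattened_sum[OF pos, of q] by simp
qed

lemma A_poly_Suc:
  "A_poly (Suc n) q 1 = 1 + (\<Sum>m\<le>n. (gauss_binomial q n m - 1) * A_poly m q 1)"
proof -
  have "flattened_sum q T = A_poly (card T) q 1" if "T \<subset> {1..Suc n}" "T \<noteq> {}" for T
    using that by (intro flattened_sum_eq_A_poly) (auto intro: finite_subset)
  then show ?thesis
    using flattened_sum_card[of "{1..Suc n}" q "\<lambda>m. A_poly m q 1"]
      A_poly_eq_flattened_sum[of "Suc n" q] by simp
qed

text \<open>
  Taking differences removes the terms \<open>- A_poly m q 1\<close>. The term \<open>m = n + 1\<close>, for which the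
  Gaussian binomial coefficient of \<open>n\<close> and \<open>m\<close> is zero, absorbs the left-hand side of the earlier
  instance.
\<close>

lemma A_poly_Suc_Suc:
  "A_poly (n + 2) q 1 =
     (\<Sum>m\<le>n + 1. (gauss_binomial q (n + 1) m - gauss_binomial q n m) * A_poly m q 1)"
proof -
  let ?A = "\<lambda>m. A_poly m q 1"
  have "?A (n + 2) = 1 + (\<Sum>m\<le>n + 1. (gauss_binomial q (n + 1) m - 1) * ?A m)"
    using A_poly_Suc[of "n + 1" q] by simp
  also have "\<dots> = 1 + (\<Sum>m\<le>n + 1. (gauss_binomial q n m - 1) * ?A m) +
      (\<Sum>m\<le>n + 1. (gauss_binomial q (n + 1) m - gauss_binomial q n m) * ?A m)"
    by (simp only: add.assoc sum.distrib[symmetric]) (simp add: algebra_simps)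
  also have "1 + (\<Sum>m\<le>n + 1. (gauss_binomial q n m - 1) * ?A m) = 0"
    using A_poly_Suc[of n q] by (simp add: gauss_binomial_eq_0)
  finally show ?thesis by simp
qed

lemma sum_atMost_odd:
  "(\<Sum>m\<le>2 * n + 1. f m) = (\<Sum>k\<le>n. f (2 * k) + f (2 * k + 1 :: nat))"
  by (induction n) (simp_all add: algebra_simps)

text \<open>
  For even \<open>m\<close> the coefficients of \<open>2 n + 1\<close> and \<open>2 n\<close> agree and cancel; for odd \<open>m\<close> only that of
  \<open>2 n + 1\<close> survives.
\<close>

lemma A_poly_minus_one_even:
  "A_poly (2 * n + 2) (- 1 :: 'a::comm_ring_1) 1 =
     (\<Sum>k\<le>n. of_nat (n choose k) * A_poly (2 * k + 1) (- 1) 1)"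
  unfolding A_poly_Suc_Suc sum_atMost_odd by (simp add: gauss_binomial_minus_one)

text \<open>
  For \<open>m = 2 k\<close> the difference of the coefficients is
  \<open>(n + 1 choose k) - (n choose k) = (n choose (k - 1))\<close>, which explains the shift from
  \<open>A_poly (2 * k)\<close> to \<open>A_poly (2 * k + 2)\<close>; for \<open>m = 2 k + 1\<close> only \<open>- (n choose k)\<close> is left.
\<close>

lemma A_poly_minus_one_odd:
  "A_poly (2 * n + 3) (- 1 :: 'a::comm_ring_1) 1 =
     (\<Sum>k\<le>n. of_nat (n choose k) * (A_poly (2 * k + 2) (- 1) 1 - A_poly (2 * k + 1) (- 1) 1))"
proof -
  let ?A = "\<lambda>m. A_poly m (- 1 :: 'a) 1"
  let ?g = "gauss_binomial (- 1 :: 'a)"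
  have "?A (2 * n + 3) = (\<Sum>m\<le>2 * n + 2. (?g (2 * n + 2) m - ?g (2 * n + 1) m) * ?A m)"
  proof -
    have "2 * n + 3 = (2 * n + 1) + 2" "2 * n + 2 = (2 * n + 1) + 1" by simp_all
    then show ?thesis using A_poly_Suc_Suc[of "2 * n + 1" "- 1 :: 'a"] by (simp only:)
  qed
  also have "\<dots> = (\<Sum>m\<le>2 * n + 1. (?g (2 * n + 2) m - ?g (2 * n + 1) m) * ?A m) + ?A (2 * n + 2)"
    by (simp add: gauss_binomial_minus_one binomial_eq_0)
  also have "(\<Sum>m\<le>2 * n + 1. (?g (2 * n + 2) m - ?g (2 * n + 1) m) * ?A m) =
      (\<Sum>k\<le>n. (of_nat (Suc n choose k) - of_nat (n choose k)) * ?A (2 * k)) -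
      (\<Sum>k\<le>n. of_nat (n choose k) * ?A (2 * k + 1))"
    unfolding sum_atMost_odd by (simp add: gauss_binomial_minus_one sum_subtractf)
  also have "\<dots> + ?A (2 * n + 2) =
      ((\<Sum>k\<le>n. (of_nat (Suc n choose k) - of_nat (n choose k)) * ?A (2 * k)) + ?A (2 * n + 2)) -
      (\<Sum>k\<le>n. of_nat (n choose k) * ?A (2 * k + 1))"
    by simp
  also have "(\<Sum>k\<le>n. (of_nat (Suc n choose k) - of_nat (n choose k)) * ?A (2 * k)) + ?A (2 * n + 2) =
      (\<Sum>k\<le>Suc n. (of_nat (Suc n choose k) - of_nat (n choose k)) * ?A (2 * k))"
    by (simp add: binomial_eq_0)
  also have "\<dots> = (\<Sum>k\<le>n. of_nat (n choose k) * ?A (2 * k + 2))"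
    by (subst sum.atMost_Suc_shift) simp
  finally show ?thesis by (simp add: algebra_simps sum_subtractf)
qed

section \<open>Stirling numbers and pairs of blocks\<close>

lemma sum_binomial_Suc:
  fixes f :: "nat \<Rightarrow> 'a::comm_semiring_1"
  shows "(\<Sum>j\<le>Suc n. of_nat (Suc n choose j) * f j) =
         (\<Sum>j\<le>n. of_nat (n choose j) * (f j + f (Suc j)))"
proof -
  have "(\<Sum>j\<le>Suc n. of_nat (Suc n choose j) * f j) =
      f 0 + (\<Sum>j\<le>n. of_nat (n choose Suc j) * f (Suc j)) + (\<Sum>j\<le>n. of_nat (n choose j) * f (Suc j))"
    by (subst sum.atMost_Suc_shift) (simp add: algebra_simps sum.distrib)
  also have "f 0 + (\<Sum>j\<le>n. of_nat (n choose Suc j) * f (Suc j)) =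
      (\<Sum>j\<le>Suc n. of_nat (n choose j) * f j)"
    by (subst sum.atMost_Suc_shift) simp
  also have "\<dots> = (\<Sum>j\<le>n. of_nat (n choose j) * f j)" by (simp add: binomial_eq_0)
  finally show ?thesis by (simp add: algebra_simps sum.distrib)
qed

text \<open>
  To partition a set with a distinguished element into \<open>k + 1\<close> blocks, choose the set of the
  \<open>j\<close> elements that are not in the block of the distinguished one, and partition it into \<open>k\<close>
  blocks.
\<close>

lemma Stirling_Suc_Suc_binomial:
  "Stirling (Suc n) (Suc k) = (\<Sum>j\<le>n. (n choose j) * Stirling j k)"
proof (induction n arbitrary: k)
  case 0
  show ?case by (cases k) simp_all
next
  case (Suc n)
  have "(\<Sum>j\<le>Suc n. (Suc n choose j) * Stirling j k) =
      (\<Sum>j\<le>n. (n choose j) * (Stirling j k + Stirling (Suc j) k))"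
    using sum_binomial_Suc[of n "\<lambda>j. Stirling j k"] by simp
  also have "\<dots> = Stirling (Suc n) (Suc k) + (\<Sum>j\<le>n. (n choose j) * Stirling (Suc j) k)"
    unfolding Suc.IH by (simp only: distrib_left sum.distrib)
  also have "(\<Sum>j\<le>n. (n choose j) * Stirling (Suc j) k) =
      k * Stirling (Suc n) (Suc k) + Stirling (Suc n) k"
  proof (cases k)
    case (Suc l)
    have "(\<Sum>j\<le>n. (n choose j) * Stirling (Suc j) (Suc l)) =
        Suc l * (\<Sum>j\<le>n. (n choose j) * Stirling j (Suc l)) + (\<Sum>j\<le>n. (n choose j) * Stirling j l)"
      unfolding Stirling.simps distrib_left sum.distrib sum_distrib_left
      by (simp add: algebra_simps sum.distrib)
    then show ?thesis unfolding Suc by (simp only: Suc.IH)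
  qed simp
  finally show ?case by simp
qed

lemma double_fact_odd_Suc:
  "double_fact (2 * int (Suc i) - 1) = (2 * int i + 1) * double_fact (2 * int i - 1)"
proof -
  let ?S = "{k. k \<in> {1..2 * int i - 1} \<and> even (2 * int i - 1 - k)}"
  have S: "{k. k \<in> {1..2 * int (Suc i) - 1} \<and> even (2 * int (Suc i) - 1 - k)} =
      insert (2 * int i + 1) ?S" (is "?L = ?R")
  proof (intro equalityI subsetI)
    fix k assume "k \<in> ?L"
    then have k: "1 \<le> k" "k \<le> 2 * int i + 1" "odd k" by auto
    have "k \<noteq> 2 * int i" using k(3) by auto
    then show "k \<in> ?R" using k by auto
  qed auto
  have "finite ?S" by (rule finite_subset[of _ "{1..2 * int i - 1}"]) auto
  then show ?thesis unfolding double_fact_def S by (subst prod.insert) auto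
qed

text \<open>
  Since \<open>(2 i - 1)!!\<close> is the number of perfect matchings of \<open>2 i\<close> objects, this counts the set
  partitions of an \<open>n\<close>-set together with a perfect matching of the blocks. Letting the sum run
  up to \<open>n\<close> instead of \<open>n div 2\<close> adds only zeros and gives a common range for all sizes up to
  \<open>n\<close>.
\<close>

definition matched_partitions :: "nat \<Rightarrow> int" where
  "matched_partitions n = (\<Sum>i\<le>n. double_fact (2 * int i - 1) * int (Stirling n (2 * i)))"

lemma matched_partitions_eq:
  assumes "n div 2 \<le> M"
  shows "matched_partitions n = (\<Sum>i\<le>M. double_fact (2 * int i - 1) * int (Stirling n (2 * i)))"
proof -
  have trunc: "(\<Sum>i\<le>N. double_fact (2 * int i - 1) * int (Stirling n (2 * i))) =
      (\<Sum>i\<le>n div 2. double_fact (2 * int i - 1) * int (Stirling n (2 * i)))"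
    if "n div 2 \<le> N" for N
    using that by (intro sum.mono_neutral_right) auto
  show ?thesis unfolding matched_partitions_def trunc[OF assms] by (rule trunc) simp
qed

lemma binomial_sum_matched_partitions:
  assumes "n \<le> M"
  shows "(\<Sum>j\<le>n. int (n choose j) * matched_partitions j) =
         (\<Sum>i\<le>M. double_fact (2 * int i - 1) * int (Stirling (Suc n) (Suc (2 * i))))"
proof -
  have "(\<Sum>j\<le>n. int (n choose j) * matched_partitions j) =
      (\<Sum>j\<le>n. \<Sum>i\<le>M. double_fact (2 * int i - 1) * (int (n choose j) * int (Stirling j (2 * i))))"
  proof (rule sum.cong[OF refl])
    fix j assume "j \<in> {..n}"
    then have "j div 2 \<le> M" using assms by auto
    then show "int (n choose j) * matched_partitions j =
        (\<Sum>i\<le>M. double_fact (2 * int i - 1) * (int (n choose j) * int (Stirling j (2 * i))))"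
      by (simp add: matched_partitions_eq[of j M] sum_distrib_left mult_ac)
  qed
  also have "\<dots> = (\<Sum>i\<le>M. \<Sum>j\<le>n.
      double_fact (2 * int i - 1) * (int (n choose j) * int (Stirling j (2 * i))))"
    by (rule sum.swap)
  finally show ?thesis
    unfolding Stirling_Suc_Suc_binomial by (simp add: sum_distrib_left)
qed

text \<open>
  The binomial transform replaces \<open>S(k, 2 i)\<close> by \<open>S(k + 1, 2 i + 1)\<close>, and
  \<open>S(k + 1, 2 i + 1) - S(k, 2 i) = (2 i + 1) S(k, 2 i + 1)\<close>; the factor turns \<open>(2 i - 1)!!\<close>
  into \<open>(2 i + 1)!!\<close>. The outer binomial transform then gives \<open>S(n + 1, 2 i + 2)\<close>, whose
  number of blocks is even again.
\<close>

lemma matched_partitions_Suc: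
  "matched_partitions (Suc n) =
     (\<Sum>k\<le>n. int (n choose k) *
        ((\<Sum>j\<le>k. int (k choose j) * matched_partitions j) - matched_partitions k))"
proof -
  let ?d = "\<lambda>i. double_fact (2 * int i - 1)"
  have diff: "(\<Sum>j\<le>k. int (k choose j) * matched_partitions j) - matched_partitions k =
      (\<Sum>i\<le>n. ?d (Suc i) * int (Stirling k (Suc (2 * i))))" if "k \<le> n" for k
  proof -
    have "k div 2 \<le> n" using that by auto
    then have k: "matched_partitions k = (\<Sum>i\<le>n. ?d i * int (Stirling k (2 * i)))"
      by (rule matched_partitions_eq)
    have "(\<Sum>j\<le>k. int (k choose j) * matched_partitions j) - matched_partitions k =
        (\<Sum>i\<le>n. ?d i * int (Stirling (Suc k) (Suc (2 * i))) - ?d i * int (Stirling k (2 * i)))"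
      unfolding binomial_sum_matched_partitions[OF that] k sum_subtractf ..
    also have "\<dots> = (\<Sum>i\<le>n. ?d (Suc i) * int (Stirling k (Suc (2 * i))))"
      unfolding double_fact_odd_Suc Stirling.simps by (simp add: algebra_simps)
    finally show ?thesis .
  qed
  have "(\<Sum>k\<le>n. int (n choose k) *
        ((\<Sum>j\<le>k. int (k choose j) * matched_partitions j) - matched_partitions k)) =
      (\<Sum>k\<le>n. \<Sum>i\<le>n. ?d (Suc i) * (int (n choose k) * int (Stirling k (Suc (2 * i)))))"
  proof (rule sum.cong[OF refl])
    fix k assume "k \<in> {..n}"
    then have "k \<le> n" by simp
    then show "int (n choose k) *
        ((\<Sum>j\<le>k. int (k choose j) * matched_partitions j) - matched_partitions k) =
        (\<Sum>i\<le>n. ?d (Suc i) * (int (n choose k) * int (Stirling k (Suc (2 * i)))))"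
      unfolding diff[OF \<open>k \<le> n\<close>] sum_distrib_left by (simp only: mult.left_commute)
  qed
  also have "\<dots> = (\<Sum>i\<le>n. \<Sum>k\<le>n. ?d (Suc i) * (int (n choose k) * int (Stirling k (Suc (2 * i)))))"
    by (rule sum.swap)
  also have "\<dots> = (\<Sum>i\<le>n. ?d (Suc i) * int (Stirling (Suc n) (2 * Suc i)))"
    unfolding mult_Suc_right add_2_eq_Suc Stirling_Suc_Suc_binomial by (simp add: sum_distrib_left)
  also have "\<dots> = matched_partitions (Suc n)"
    unfolding matched_partitions_def by (subst sum.atMost_Suc_shift) simp
  finally show ?thesis by simp
qed

lemma A_poly_odd_eq_matched_partitions:
  "A_poly (2 * n + 1) (- 1) 1 = matched_partitions n"
proof (induction n rule: less_induct)
  case (less n)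
  show ?case
  proof (cases n)
    case 0
    have "{k :: int. 1 \<le> k \<and> k \<le> - 1 \<and> P k} = {}" for P by auto
    then show ?thesis
      using A_poly_Suc[of 0 "- 1 :: int"] 0 by (simp add: matched_partitions_def double_fact_def)
  next
    case (Suc m)
    have "2 * n + 1 = 2 * m + 3" using Suc by simp
    then have "A_poly (2 * n + 1) (- 1 :: int) 1 = (\<Sum>k\<le>m. int (m choose k) *
        ((\<Sum>j\<le>k. int (k choose j) * A_poly (2 * j + 1) (- 1) 1) - A_poly (2 * k + 1) (- 1) 1))"
      by (simp only: A_poly_minus_one_odd A_poly_minus_one_even)
    also have "\<dots> = (\<Sum>k\<le>m. int (m choose k) *
        ((\<Sum>j\<le>k. int (k choose j) * matched_partitions j) - matched_partitions k))"
    proof (rule sum.cong[OF refl])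
      fix k assume "k \<in> {..m}"
      then have "A_poly (2 * j + 1) (- 1) 1 = matched_partitions j" if "j \<le> k" for j
        using less.IH[of j] that Suc by simp
      then show "int (m choose k) *
          ((\<Sum>j\<le>k. int (k choose j) * A_poly (2 * j + 1) (- 1) 1) - A_poly (2 * k + 1) (- 1) 1) =
          int (m choose k) *
          ((\<Sum>j\<le>k. int (k choose j) * matched_partitions j) - matched_partitions k)"
        by simp
    qed
    also have "\<dots> = matched_partitions n" unfolding Suc matched_partitions_Suc ..
    finally show ?thesis .
  qed
qed

theorem theorem2p3:
  fixes n :: nat
  shows "A_poly (2 * n + 1) (-1 :: int) 1 =
           (\<Sum>i = 0..n div 2. double_fact (2 * int i - 1) * int (Stirling n (2 * i)))
       \<and> A_poly (2 * n + 2) (-1 :: int) 1 =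
           (\<Sum>i = 0..n div 2. \<Sum>j = 2 * i..n.
              double_fact (2 * int i - 1) * int (n choose j) * int (Stirling j (2 * i)))"
proof
  show "A_poly (2 * n + 1) (-1 :: int) 1 =
      (\<Sum>i = 0..n div 2. double_fact (2 * int i - 1) * int (Stirling n (2 * i)))"
    unfolding A_poly_odd_eq_matched_partitions atLeast0AtMost
    by (rule matched_partitions_eq) simp
next
  let ?t = "\<lambda>i j. double_fact (2 * int i - 1) * int (n choose j) * int (Stirling j (2 * i))"
  have "A_poly (2 * n + 2) (-1 :: int) 1 = (\<Sum>j\<le>n. int (n choose j) * matched_partitions j)"
    unfolding A_poly_minus_one_even A_poly_odd_eq_matched_partitions by simp
  also have "\<dots> = (\<Sum>j\<le>n. \<Sum>i\<le>n div 2. ?t i j)"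
  proof (rule sum.cong[OF refl])
    fix j assume "j \<in> {..n}"
    then have "j div 2 \<le> n div 2" by (simp add: div_le_mono)
    then show "int (n choose j) * matched_partitions j = (\<Sum>i\<le>n div 2. ?t i j)"
      by (simp add: matched_partitions_eq[of j "n div 2"] sum_distrib_left mult_ac)
  qed
  also have "\<dots> = (\<Sum>i\<le>n div 2. \<Sum>j\<le>n. ?t i j)" by (rule sum.swap)
  also have "\<dots> = (\<Sum>i\<le>n div 2. \<Sum>j = 2 * i..n. ?t i j)"
    by (intro sum.cong refl sum.mono_neutral_right) auto
  finally show "A_poly (2 * n + 2) (-1 :: int) 1 = (\<Sum>i = 0..n div 2. \<Sum>j = 2 * i..n. ?t i j)"
    by (simp add: atLeast0AtMost)
qed

end
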